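(* For each $n\ge1$ let $X_n$ have the stationary distribution of the load balancing process $\boldsymbol{X}_n$ of the dandelion network $G_n$ with dispatchers $\{1,\dots,n\}$, central servers $C$ and boundary servers $B_1,\dots,B_n$, arrival rate $\lambda$ at every dispatcher and service rate $\mu$ at every server, where $\lambda<\mu|B_1|$. Then $$\lim_{n\to\infty}P(X_n(c)\ge k)=1\quad\text{for all } k\in\mathbb{N}\text{ and } c\in C.$$ In particular, $E[X_n(c)]\to\infty$ as $n\to\infty$ for all $c\in C$.
   Context: $\mathbb{N}=\{0,1,2,\dots\}$. Load balancing process: for a bipartite graph $G=(D,S,E)$ with finite sets $D$ (dispatchers), $S$ (servers), $E\subset D\times S$, and rates $\lambda:D\to(0,\infty)$, $\mu:S\to(0,\infty)$, dispatcher $d$ receives tasks as an independent Poisson process of rate $\lambda(d)$ and sends each task to a server chosen uniformly at random among the servers $u$ with $(d,u)\in E$ having the least number of tasks; each server $u$ executes tasks sequentially with independent exponential service times of rate $\mu(u)$. $\boldsymbol{X}(t,u)$ is the number of tasks in server $u$ at time $t$; $\boldsymbol{X}$ is a continuous-time Markov chain on $\mathbb{N}^S$. Dandelion networks: fix a finite set $C$ (central servers) and finite sets $B_1,B_2,\dots$ (boundary servers) of the same cardinality, all these sets being pairwise disjoint. For $n\ge1$, $G_n=(D_n,S_n,E_n)$ with $D_n=\{1,\dots,n\}$, $S_n=C\cup\bigcup_{d\in D_n}B_d$ and $E_n=\bigcup_{d\in D_n}\{d\}\times(B_d\cup C)$. $\boldsymbol{X}_n$ is the load balancing process associated with $G_n$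 with constant arrival rate $\lambda>0$ and constant service rate $\mu>0$, $\lambda<\mu|B_1|$; under this condition $\boldsymbol{X}_n$ is ergodic. *)

theory Defs
  imports "HOL-Probability.Probability"
begin

section \<open>Continuous-time Markov chains on a countable state space\<close>

text \<open>
  A chain is given by its state space \<open>\<Omega>\<close> and its jump rates \<open>q x y\<close> for \<open>x \<noteq> y\<close>; the values
  \<open>q x x\<close> are ignored. The infinite sum below is \<open>0\<close> by convention if it diverges, so the
  definition is meaningful only if the total jump rate out of every state is finite.
\<close>

definition rate_matrix :: "'x set \<Rightarrow> ('x \<Rightarrow> 'x \<Rightarrow> real) \<Rightarrow> 'x \<Rightarrow> 'x \<Rightarrow> real" where
  "rate_matrix \<Omega> q x y = (if x = y then - (\<Sum>\<^sub>\<infinity>z\<in>\<Omega> - {x}. q x z) else q x y)"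

text \<open>
  \<open>P t x\<close> is the law at time \<open>t\<close> of the chain started from \<open>x\<close>: an honest Markov semigroup on
  \<open>\<Omega>\<close> whose right derivative at time \<open>0\<close> is the rate matrix. For a rate matrix with bounded
  diagonal there is exactly one such semigroup (up to its values outside \<open>\<Omega>\<close> and at negative
  times).
\<close>

definition transition_semigroup ::
    "'x set \<Rightarrow> ('x \<Rightarrow> 'x \<Rightarrow> real) \<Rightarrow> (real \<Rightarrow> 'x \<Rightarrow> 'x pmf) \<Rightarrow> bool" where
  "transition_semigroup \<Omega> q P \<longleftrightarrow>
     (\<forall>t\<ge>0. \<forall>x\<in>\<Omega>. set_pmf (P t x) \<subseteq> \<Omega>) \<and>
     (\<forall>x\<in>\<Omega>. P 0 x = return_pmf x) \<and>
     (\<forall>s\<ge>0. \<forall>t\<ge>0. \<forall>x\<in>\<Omega>. P (s + t) x = bind_pmf (P s x) (P t)) \<and>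
     (\<forall>x\<in>\<Omega>. \<forall>y\<in>\<Omega>.
        ((\<lambda>t. pmf (P t x) y) has_real_derivative rate_matrix \<Omega> q x y) (at 0 within {0..}))"

definition stationary_distribution ::
    "'x set \<Rightarrow> ('x \<Rightarrow> 'x \<Rightarrow> real) \<Rightarrow> 'x pmf \<Rightarrow> bool" where
  "stationary_distribution \<Omega> q \<pi> \<longleftrightarrow>
     set_pmf \<pi> \<subseteq> \<Omega> \<and>
     (\<exists>P. transition_semigroup \<Omega> q P \<and> (\<forall>t\<ge>0. bind_pmf \<pi> (P t) = \<pi>))"


section \<open>The load balancing process\<close>

text \<open>
  States are extensional functions, so that \<open>load_states S\<close> is \<open>\<nat>\<^sup>S\<close> and is countable for finite \<open>S\<close>.
\<close>

definition load_states :: "'s set \<Rightarrow> ('s \<Rightarrow> nat) set" where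
  "load_states S = S \<rightarrow>\<^sub>E UNIV"

definition shortest_queues :: "('d \<times> 's) set \<Rightarrow> 'd \<Rightarrow> ('s \<Rightarrow> nat) \<Rightarrow> 's set" where
  "shortest_queues E d x = {u. is_arg_min x (\<lambda>v. (d, v) \<in> E) u}"

definition arrival_rate ::
    "'d set \<Rightarrow> ('d \<times> 's) set \<Rightarrow> ('d \<Rightarrow> real) \<Rightarrow> ('s \<Rightarrow> nat) \<Rightarrow> 's \<Rightarrow> real" where
  "arrival_rate D E lam x u =
     (\<Sum>d | d \<in> D \<and> u \<in> shortest_queues E d x. lam d / real (card (shortest_queues E d x)))"

definition departure_rate :: "('s \<Rightarrow> real) \<Rightarrow> ('s \<Rightarrow> nat) \<Rightarrow> 's \<Rightarrow> real" where
  "departure_rate mu x u = (if x u > 0 then mu u else 0)"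

definition load_balancing_rate ::
    "'d set \<Rightarrow> 's set \<Rightarrow> ('d \<times> 's) set \<Rightarrow> ('d \<Rightarrow> real) \<Rightarrow> ('s \<Rightarrow> real) \<Rightarrow>
     ('s \<Rightarrow> nat) \<Rightarrow> ('s \<Rightarrow> nat) \<Rightarrow> real" where
  "load_balancing_rate D S E lam mu x y =
     (\<Sum>u | u \<in> S \<and> y = x(u := x u + 1). arrival_rate D E lam x u) +
     (\<Sum>u | u \<in> S \<and> y = x(u := x u - 1). departure_rate mu x u)"

definition load_balancing_stationary ::
    "'d set \<Rightarrow> 's set \<Rightarrow> ('d \<times> 's) set \<Rightarrow> ('d \<Rightarrow> real) \<Rightarrow> ('s \<Rightarrow> real) \<Rightarrow>
     ('s \<Rightarrow> nat) pmf \<Rightarrow> bool" where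
  "load_balancing_stationary D S E lam mu \<pi> \<longleftrightarrow>
     stationary_distribution (load_states S) (load_balancing_rate D S E lam mu) \<pi>"


section \<open>Dandelion networks\<close>

definition dandelion_dispatchers :: "nat \<Rightarrow> nat set" where
  "dandelion_dispatchers n = {1..n}"

definition dandelion_servers :: "'s set \<Rightarrow> (nat \<Rightarrow> 's set) \<Rightarrow> nat \<Rightarrow> 's set" where
  "dandelion_servers C B n = C \<union> (\<Union>d\<in>dandelion_dispatchers n. B d)"

definition dandelion_edges :: "'s set \<Rightarrow> (nat \<Rightarrow> 's set) \<Rightarrow> nat \<Rightarrow> (nat \<times> 's) set" where
  "dandelion_edges C B n = (\<Union>d\<in>dandelion_dispatchers n. {d} \<times> (B d \<union> C))"

end

theory Submission
  imports Defs
begin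

text \<open>
  In equilibrium the probability flow into a set \<open>A\<close> of states equals the flow out of it, so a
  lower bound \<open>a\<close> on the rate of entering \<open>A\<close> from a set \<open>H\<close> and an upper bound \<open>b\<close> on the rate of
  leaving \<open>A\<close> give \<open>a P(H) \<le> b\<close>. All sets used are of the form \<open>Y > m\<close> for a quantity \<open>Y\<close>.

  Suppose that every central server has at least \<open>k\<close> tasks with probability tending to \<open>1\<close>. Give
  dispatcher \<open>d\<close> the load \<open>\<Sum>u\<in>B d. min (x u) k\<close>, and let \<open>Y\<^sub>j\<close> be the number of dispatchers of load
  at least \<open>j\<close>. A dispatcher of load \<open>j < k |B|\<close> sends its tasks to its boundary servers, so
  \<open>Y\<^sub>j\<^sub>+\<^sub>1\<close> increases at rate at least \<open>\<lambda> (Y\<^sub>j - Y\<^sub>j\<^sub>+\<^sub>1)\<close>, whereas it leaves \<open>Y\<^sub>j\<^sub>+\<^sub>1 = m + 1\<close> downwards at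
  rate at most \<open>(m + 1) |B| \<mu>\<close>. As \<open>Y\<^sub>0 = n\<close>, induction on \<open>j\<close> shows that \<open>Y\<^sub>j\<close> tends to infinity in
  probability for \<open>j \<le> k |B|\<close>. Finally, if \<open>j = k |B|\<close> and a central server has exactly \<open>k\<close> tasks, it
  receives tasks at rate at least \<open>\<lambda> Y\<^sub>j / (|B| + |C|)\<close> but executes them only at rate \<open>\<mu>\<close>, so
  that this event has probability tending to \<open>0\<close>.
\<close>

section \<open>Probability flow across a cut\<close>

text \<open>Turns a right derivative at 0 into a limit along a positive sequence, the form needed
  for subdividing a time interval and for dominated convergence.\<close>

lemma filterlim_const_over_Suc_at_0_within:
  "t > 0 \<Longrightarrow> filterlim (\<lambda>n. t / real (Suc n)) (at (0::real) within {0..}) sequentially"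
  unfolding filterlim_at
  using LIMSEQ_Suc[OF lim_const_over_n, of t] by (auto intro!: always_eventually)

text \<open>The probability \<open>h\<close> of being away from \<open>x\<close> is subadditive in
  time, so \<open>h t \<le> n * h (t / n)\<close>, and the right side tends to \<open>t\<close>
  times the derivative of \<open>h\<close> at 0. This bound later dominates the difference quotients
  of the semigroup.\<close>

lemma one_minus_stay_prob_le:
  assumes P: "transition_semigroup \<Omega> q P" and x: "x \<in> \<Omega>" and t: "t \<ge> 0"
  shows "1 - pmf (P t x) x \<le> - rate_matrix \<Omega> q x x * t"
proof -
  define h where "h s = 1 - pmf (P s x) x" for s
  have h0: "h 0 = 0" using P x by (simp add: h_def transition_semigroup_def)
  have sub: "h (r + s) \<le> h r + h s" if "r \<ge> 0" "s \<ge> 0" for r s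
  proof -
    \<comment> \<open>Chapman-Kolmogorov, keeping only the paths that are at \<open>x\<close> at the
      intermediate time \<open>r\<close>.\<close>
    have "pmf (P r x) x * pmf (P s x) x
          = (\<integral>y. pmf (P s x) x * indicator {x} y \<partial>measure_pmf (P r x))"
      by (simp add: measure_pmf_single)
    also have "\<dots> \<le> (\<integral>y. pmf (P s y) x \<partial>measure_pmf (P r x))"
      by (intro integral_mono measure_pmf.integrable_const_bound[where B=1])
         (auto simp: indicator_def pmf_le_1)
    also have "\<dots> = pmf (P (r + s) x) x"
      using P x that by (simp add: transition_semigroup_def pmf_bind)
    finally have "pmf (P r x) x * pmf (P s x) x \<le> pmf (P (r + s) x) x" .
    moreover have "0 \<le> (1 - pmf (P r x) x) * (1 - pmf (P s x) x)"
      by (simp add: pmf_le_1)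
    ultimately show ?thesis by (simp add: h_def algebra_simps)
  qed
  have mult: "h (real n * s) \<le> real n * h s" if "s \<ge> 0" for n s
  proof (induction n)
    case (Suc n)
    then show ?case using sub[of "real n * s" s] that by (simp add: algebra_simps)
  qed (simp add: h0)
  show ?thesis
  proof (cases "t = 0")
    case False
    then have t: "t > 0" using t by simp
    have "((\<lambda>t. pmf (P t x) x) has_real_derivative rate_matrix \<Omega> q x x) (at 0 within {0..})"
      using P x by (auto simp: transition_semigroup_def)
    then have "((\<lambda>s. (pmf (P s x) x - pmf (P 0 x) x) / (s - 0)) \<longlongrightarrow> rate_matrix \<Omega> q x x)
                 (at 0 within {0..})"
      by (simp only: has_field_derivative_iff)
    from filterlim_compose[OF this filterlim_const_over_Suc_at_0_within[OF t]]
    have "(\<lambda>n. - (t * ((pmf (P (t / real (Suc n)) x) x - 1) / (t / real (Suc n)))))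
             \<longlonglongrightarrow> - (t * rate_matrix \<Omega> q x x)"
      using P x by (intro tendsto_minus tendsto_mult_left) (simp add: transition_semigroup_def)
    moreover have "h t \<le> - (t * ((pmf (P (t / real (Suc n)) x) x - 1) / (t / real (Suc n))))" for n
    proof -
      have "h t \<le> real (Suc n) * h (t / real (Suc n))"
        using mult[of "t / real (Suc n)" "Suc n"] t by simp
      also have "\<dots> = - (t * ((pmf (P (t / real (Suc n)) x) x - 1) / (t / real (Suc n))))"
        using t by (simp add: h_def divide_simps del: of_nat_Suc) (simp add: algebra_simps)
      finally show ?thesis .
    qed
    ultimately have "h t \<le> - (t * rate_matrix \<Omega> q x x)"
      by (intro LIMSEQ_le_const) auto
    then show ?thesis by (simp add: h_def mult.commute)
  qed (use h0 in \<open>simp add: h_def\<close>)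
qed

text \<open>The semigroup is given as differentiable only at single states, whereas \<open>A\<close>
  may be infinite. All positive rates out of \<open>x\<close> lead into the finite set
  \<open>N\<close>, and the row of the rate matrix sums to 0 over \<open>N\<close>, so the mass
  outside \<open>N\<close> is o(t) and does not affect the derivative.\<close>

lemma transition_prob_has_derivative:
  assumes P: "transition_semigroup \<Omega> q P" and x: "x \<in> \<Omega>"
    and N: "finite N" "N \<subseteq> \<Omega>" "x \<in> N" "\<And>y. y \<in> \<Omega> - N \<Longrightarrow> q x y = 0"
  shows "((\<lambda>t. measure_pmf.prob (P t x) A) has_real_derivative
           (\<Sum>y\<in>N \<inter> A. rate_matrix \<Omega> q x y)) (at 0 within {0..})"
proof -
  let ?R = "\<lambda>A. \<Sum>y\<in>N \<inter> A. rate_matrix \<Omega> q x y"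
  let ?p = "\<lambda>A t. measure_pmf.prob (P t x) (N \<inter> A)"
  have der: "(?p A has_real_derivative ?R A) (at 0 within {0..})" for A
  proof -
    have "((\<lambda>t. \<Sum>y\<in>N \<inter> A. pmf (P t x) y) has_real_derivative ?R A) (at 0 within {0..})"
      using P x N unfolding transition_semigroup_def by (intro DERIV_sum) blast
    then show ?thesis using N by (simp add: measure_measure_pmf_finite)
  qed
  \<comment> \<open>The infinite sum in the diagonal entry reduces to \<open>N\<close>, so that it
    cancels the off-diagonal rates.\<close>
  have "?R UNIV = 0"
  proof -
    have "(\<Sum>\<^sub>\<infinity>z\<in>\<Omega> - {x}. q x z) = (\<Sum>\<^sub>\<infinity>z\<in>N - {x}. q x z)"
      using N by (intro infsum_cong_neutral) auto
    also have "\<dots> = (\<Sum>z\<in>N - {x}. q x z)" using N by (simp add: infsum_finite)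
    also have "\<dots> = (\<Sum>z\<in>N - {x}. rate_matrix \<Omega> q x z)"
      by (intro sum.cong) (auto simp: rate_matrix_def)
    finally show ?thesis using sum.remove[OF N(1) N(3), of "rate_matrix \<Omega> q x"]
      by (simp add: rate_matrix_def)
  qed
  with der[of UNIV] have tail: "(?p UNIV has_real_derivative 0) (at 0 within {0..})" by simp
  have at0: "measure_pmf.prob (P 0 x) Z = indicator Z x" for Z
    using P x by (simp add: transition_semigroup_def)
  have "((\<lambda>t. (measure_pmf.prob (P t x) A - measure_pmf.prob (P 0 x) A) / (t - 0)) \<longlongrightarrow> ?R A)
          (at 0 within {0..})"
  proof (rule tendsto_sandwich)
    show "((\<lambda>t. (?p A t - ?p A 0) / (t - 0)) \<longlongrightarrow> ?R A) (at 0 within {0..})"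
      using der[of A] by (simp only: has_field_derivative_iff)
    \<comment> \<open>The upper bound adds the mass outside \<open>N\<close>, which is
      \<open>?p UNIV 0 - ?p UNIV t\<close> because the chain starts in \<open>N\<close>.\<close>
    show "((\<lambda>t. (?p A t - ?p A 0) / (t - 0) - (?p UNIV t - ?p UNIV 0) / (t - 0)) \<longlongrightarrow> ?R A)
            (at 0 within {0..})"
      using tendsto_diff[OF der[of A, unfolded has_field_derivative_iff]
          tail[unfolded has_field_derivative_iff]] by simp
    have pos: "\<forall>\<^sub>F t in at 0 within {0..}. (t::real) > 0"
      by (auto simp: eventually_at_filter)
    have eq: "indicator (N \<inter> Z) x = (indicator Z x :: real)" for Z
      using N by (simp add: indicator_def)
    show "\<forall>\<^sub>F t in at 0 within {0..}. (?p A t - ?p A 0) / (t - 0)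
            \<le> (measure_pmf.prob (P t x) A - measure_pmf.prob (P 0 x) A) / (t - 0)"
      using pos by eventually_elim
        (auto simp: at0 eq intro!: divide_right_mono measure_pmf.finite_measure_mono)
    show "\<forall>\<^sub>F t in at 0 within {0..}.
            (measure_pmf.prob (P t x) A - measure_pmf.prob (P 0 x) A) / (t - 0)
            \<le> (?p A t - ?p A 0) / (t - 0) - (?p UNIV t - ?p UNIV 0) / (t - 0)"
      using pos
    proof eventually_elim
      case (elim t)
      have "measure_pmf.prob (P t x) A + ?p UNIV t
              = measure_pmf.prob (P t x) (A \<union> N) + measure_pmf.prob (P t x) (A \<inter> N)"
        by (subst measure_pmf.finite_measure_Union') 
           (auto simp: measure_pmf.finite_measure_Diff' Int_commute)
      also have "\<dots> \<le> 1 + ?p A t" by (auto simp: Int_commute measure_pmf.prob_le_1)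
      finally show ?case using elim
        by (auto simp: at0 eq N(3) simp flip: diff_divide_distrib intro!: divide_right_mono)
    qed
  qed
  then show ?thesis by (simp only: has_field_derivative_iff)
qed

text \<open>Invariance makes the mean of each difference quotient \<open>g n\<close> zero. The
  quotients converge to the generator applied to the indicator of \<open>A\<close> and are bounded
  by \<open>Q\<close>, so dominated convergence carries this over to the limit.\<close>

lemma stationary_generator_indicator:
  assumes stat: "stationary_distribution \<Omega> q \<pi>"
    and N: "\<And>x. x \<in> \<Omega> \<Longrightarrow> finite (N x) \<and> N x \<subseteq> \<Omega> \<and> x \<in> N x \<and> (\<forall>y\<in>\<Omega> - N x. q x y = 0)"
    and Q: "\<And>x. x \<in> \<Omega> \<Longrightarrow> - rate_matrix \<Omega> q x x \<le> Q"
  shows "integrable (measure_pmf \<pi>) (\<lambda>x. \<Sum>y\<in>N x \<inter> A. rate_matrix \<Omega> q x y)" (is "integrable _ ?G")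
    and "(\<integral>x. (\<Sum>y\<in>N x \<inter> A. rate_matrix \<Omega> q x y) \<partial>measure_pmf \<pi>) = 0"
proof -
  from stat obtain P where P: "transition_semigroup \<Omega> q P"
    and inv: "\<And>t. t \<ge> 0 \<Longrightarrow> bind_pmf \<pi> (P t) = \<pi>" and supp: "set_pmf \<pi> \<subseteq> \<Omega>"
    by (auto simp: stationary_distribution_def)
  define r where "r n = 1 / real (Suc n)" for n
  have r: "r n > 0" for n by (simp add: r_def)
  define g where "g n x = (measure_pmf.prob (P (r n) x) A - indicator A x) / r n" for n x
  have lim: "(\<lambda>n. g n x) \<longlonglongrightarrow> ?G x" if "x \<in> \<Omega>" for x
  proof -
    have "((\<lambda>t. (measure_pmf.prob (P t x) A - measure_pmf.prob (P 0 x) A) / (t - 0)) \<longlongrightarrow> ?G x)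
          (at 0 within {0..})"
      using transition_prob_has_derivative[OF P that, of "N x" A] N[OF that]
      by (auto simp only: has_field_derivative_iff)
    from filterlim_compose[OF this filterlim_const_over_Suc_at_0_within[of 1]] show ?thesis
      using P that by (simp add: g_def r_def transition_semigroup_def)
  qed
  have bnd: "norm (g n x) \<le> Q" if "x \<in> \<Omega>" for n x
  proof -
    let ?p = "measure_pmf.prob (P (r n) x)"
    \<comment> \<open>The indicator of \<open>A\<close> can only have changed if the chain is no
      longer at \<open>x\<close>.\<close>
    have "\<bar>?p A - indicator A x\<bar> \<le> 1 - pmf (P (r n) x) x"
    proof (cases "x \<in> A")
      case True
      then have "pmf (P (r n) x) x \<le> ?p A"
        by (auto simp: simp flip: measure_pmf_single intro!: measure_pmf.finite_measure_mono)
      then show ?thesis using True by (simp add: measure_pmf.prob_le_1)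
    next
      case False
      then have "?p A \<le> ?p (- {x})" by (intro measure_pmf.finite_measure_mono) auto
      also have "\<dots> = 1 - pmf (P (r n) x) x"
        using measure_pmf.prob_compl[of "{x}" "P (r n) x"]
        by (simp add: Compl_eq_Diff_UNIV measure_pmf_single)
      finally show ?thesis using False by simp
    qed
    also have "\<dots> \<le> - rate_matrix \<Omega> q x x * r n"
      using one_minus_stay_prob_le[OF P that, of "r n"] r[of n] by simp
    also have "\<dots> \<le> Q * r n" using Q[OF that] r[of n] by (intro mult_right_mono) auto
    finally show ?thesis using r[of n] by (simp add: g_def field_simps abs_divide)
  qed
  have AE: "AE x in measure_pmf \<pi>. x \<in> \<Omega>" using supp by (auto simp: AE_measure_pmf_iff)
  have dct: "integrable (measure_pmf \<pi>) ?G"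
       "(\<lambda>n. \<integral>x. g n x \<partial>measure_pmf \<pi>) \<longlonglongrightarrow> (\<integral>x. ?G x \<partial>measure_pmf \<pi>)"
    using AE lim bnd
    by (auto intro!: integrable_dominated_convergence[where w = "\<lambda>_. Q" and s = g]
        integral_dominated_convergence[where w = "\<lambda>_. Q"] elim!: eventually_mono)
  have "(\<integral>x. g n x \<partial>measure_pmf \<pi>) = 0" for n
  proof -
    have i: "integrable (measure_pmf \<pi>) (\<lambda>x. measure_pmf.prob (P (r n) x) A)"
      by (intro measure_pmf.integrable_const_bound[where B=1]) (auto simp: measure_pmf.prob_le_1)
    have "(\<integral>x. measure_pmf.prob (P (r n) x) A \<partial>measure_pmf \<pi>)
            = measure_pmf.prob (bind_pmf \<pi> (P (r n))) A"
    proof -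
      have "ennreal (measure_pmf.prob (bind_pmf \<pi> (P (r n))) A)
              = (\<integral>\<^sup>+x. ennreal (measure_pmf.prob (P (r n) x) A) \<partial>measure_pmf \<pi>)"
        by (simp add: emeasure_bind_pmf flip: measure_pmf.emeasure_eq_measure)
      also have "\<dots> = ennreal (\<integral>x. measure_pmf.prob (P (r n) x) A \<partial>measure_pmf \<pi>)"
        using i by (intro nn_integral_eq_integral) auto
      finally show ?thesis by (simp add: integral_nonneg)
    qed
    also have "\<dots> = measure_pmf.prob \<pi> A" using inv[of "r n"] r[of n] by simp
    finally show ?thesis using i by (simp add: g_def measure_pmf.integrable_const_bound[where B = 1])
  qed
  with dct show "integrable (measure_pmf \<pi>) ?G" "(\<integral>x. ?G x \<partial>measure_pmf \<pi>) = 0"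
    by (simp_all add: LIMSEQ_const_iff)
qed

text \<open>The generator applied to the indicator of \<open>A\<close> is minus the outflow on
  \<open>A\<close>, which \<open>H\<close> avoids, and the inflow off \<open>A\<close>; hence it
  dominates \<open>a * indicator H x - b\<close>. Integrating against \<open>\<pi>\<close> gives the
  bound, whatever the sign of \<open>a\<close>.\<close>

lemma stationary_cut_bound:
  assumes stat: "stationary_distribution \<Omega> q \<pi>"
    and N: "\<And>x. x \<in> \<Omega> \<Longrightarrow> finite (N x) \<and> N x \<subseteq> \<Omega> \<and> (\<forall>y\<in>\<Omega> - N x. q x y = 0)"
    and q: "\<And>x y. x \<in> \<Omega> \<Longrightarrow> y \<in> \<Omega> \<Longrightarrow> q x y \<ge> 0"
    and Q: "\<And>x. x \<in> \<Omega> \<Longrightarrow> (\<Sum>y\<in>N x. q x y) \<le> Q"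
    and inflow: "\<And>x. x \<in> \<Omega> \<Longrightarrow> x \<in> H \<Longrightarrow> x \<notin> A \<and> a \<le> (\<Sum>y\<in>N x \<inter> A. q x y)"
    and outflow: "\<And>x. x \<in> \<Omega> \<Longrightarrow> x \<in> A \<Longrightarrow> (\<Sum>y\<in>N x - A. q x y) \<le> b"
    and b: "b \<ge> 0"
  shows "a * measure_pmf.prob \<pi> H \<le> b"
proof -
  \<comment> \<open>The generator sum must include the diagonal entry, whether or not
    \<open>x\<close> itself belongs to \<open>N x\<close>.\<close>
  let ?M = "\<lambda>x. insert x (N x)"
  let ?G = "\<lambda>x. \<Sum>y\<in>?M x \<inter> A. rate_matrix \<Omega> q x y"
  have M: "finite (?M x) \<and> ?M x \<subseteq> \<Omega> \<and> x \<in> ?M x \<and> (\<forall>y\<in>\<Omega> - ?M x. q x y = 0)" if "x \<in> \<Omega>" for x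
    using N[OF that] that by auto
  have diag: "- rate_matrix \<Omega> q x x = (\<Sum>y\<in>N x - {x}. q x y)" if "x \<in> \<Omega>" for x
  proof -
    have "(\<Sum>\<^sub>\<infinity>z\<in>\<Omega> - {x}. q x z) = (\<Sum>\<^sub>\<infinity>z\<in>N x - {x}. q x z)"
      using N[OF that] by (intro infsum_cong_neutral) auto
    then show ?thesis using N[OF that] by (simp add: infsum_finite rate_matrix_def)
  qed
  have "- rate_matrix \<Omega> q x x \<le> Q" if "x \<in> \<Omega>" for x
  proof -
    have "(\<Sum>y\<in>N x - {x}. q x y) \<le> (\<Sum>y\<in>N x. q x y)"
      using N[OF that] q that by (intro sum_mono2) auto
    then show ?thesis using diag Q that by fastforce
  qed
  note gen = stationary_generator_indicator[OF stat M this, of A]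
  have low: "a * indicator H x - b \<le> ?G x" if x: "x \<in> \<Omega>" for x
  proof (cases "x \<in> A")
    case True
    have fin: "finite (N x)" using N x by blast
    \<comment> \<open>The diagonal entry cancels the jumps within \<open>A\<close> and leaves minus
      the flow out of \<open>A\<close>.\<close>
    have "?M x \<inter> A = insert x (N x \<inter> A - {x})" using True by auto
    then have "?G x = rate_matrix \<Omega> q x x + (\<Sum>y\<in>N x \<inter> A - {x}. rate_matrix \<Omega> q x y)"
      using fin by (simp only: sum.insert_remove[OF finite_Int[OF disjI1]]) (simp add: sum.insert_remove)
    also have "(\<Sum>y\<in>N x \<inter> A - {x}. rate_matrix \<Omega> q x y) = (\<Sum>y\<in>N x \<inter> A - {x}. q x y)"
      by (intro sum.cong) (auto simp: rate_matrix_def)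
    also have "rate_matrix \<Omega> q x x = - (\<Sum>y\<in>N x - {x}. q x y)"
      using diag[OF x] by simp
    also have "N x - {x} = (N x \<inter> A - {x}) \<union> (N x - A)" using True by auto
    also have "(\<Sum>y\<in>\<dots>. q x y) = (\<Sum>y\<in>N x \<inter> A - {x}. q x y) + (\<Sum>y\<in>N x - A. q x y)"
      using fin by (intro sum.union_disjoint) auto
    finally have "?G x = - (\<Sum>y\<in>N x - A. q x y)" by simp
    then show ?thesis using outflow[OF x True] inflow[OF x] True by (auto simp: indicator_def)
  next
    case False
    then have "?G x = (\<Sum>y\<in>N x \<inter> A. q x y)"
      by (intro sum.cong) (auto simp: rate_matrix_def)
    moreover have "\<dots> \<ge> 0" using N[OF x] q x by (intro sum_nonneg) auto
    ultimately show ?thesis using inflow[OF x] b by (auto simp: indicator_def)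
  qed
  have int: "integrable (measure_pmf \<pi>) (\<lambda>x. a * indicator H x :: real)"
    by (intro integrable_mult_right measure_pmf.integrable_const_bound[where B = 1]) auto
  have "set_pmf \<pi> \<subseteq> \<Omega>" using stat by (simp add: stationary_distribution_def)
  then have "(\<integral>x. a * indicator H x - b \<partial>measure_pmf \<pi>) \<le> (\<integral>x. ?G x \<partial>measure_pmf \<pi>)"
    using low by (intro integral_mono_AE gen Bochner_Integration.integrable_diff int)
      (auto simp: AE_measure_pmf_iff)
  also have "\<dots> = 0" by (rule gen)
  finally show ?thesis using int by simp
qed


section \<open>Cuts of the load balancing process\<close>

lemma shortest_queues_subset: "shortest_queues E d x \<subseteq> {u. (d, u) \<in> E}"
  by (auto simp: shortest_queues_def is_arg_min_def)

lemma shortest_queues_nonempty: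
  assumes "finite {u. (d, u) \<in> E}" "(d, v) \<in> E"
  shows "shortest_queues E d x \<noteq> {}"
  using ex_is_arg_min_if_finite[of "{u. (d, u) \<in> E}" x] assms by (auto simp: shortest_queues_def)

lemma shortest_queues_le: "u \<in> shortest_queues E d x \<Longrightarrow> (d, v) \<in> E \<Longrightarrow> x u \<le> x v"
  by (auto simp: shortest_queues_def is_arg_min_linorder)

lemma arrival_rate_nonneg: "(\<And>d. d \<in> D \<Longrightarrow> lam d \<ge> 0) \<Longrightarrow> arrival_rate D E lam x u \<ge> 0"
  unfolding arrival_rate_def by (intro sum_nonneg) auto

lemma arrival_rate_le:
  assumes "finite D" "\<And>d. d \<in> D \<Longrightarrow> lam d \<ge> 0"
  shows "arrival_rate D E lam x u \<le> (\<Sum>d\<in>D. lam d)"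
proof -
  \<comment> \<open>If the cardinality is 0, the quotient is 0 by the convention for division by
    zero.\<close>
  have "lam d / real (card (shortest_queues E d x)) \<le> lam d" if "d \<in> D" for d
    using assms(2)[OF that] by (cases "card (shortest_queues E d x)") (auto simp: divide_simps algebra_simps)
  then have "arrival_rate D E lam x u \<le> (\<Sum>d | d \<in> D \<and> u \<in> shortest_queues E d x. lam d)"
    unfolding arrival_rate_def by (intro sum_mono) auto
  also have "\<dots> \<le> (\<Sum>d\<in>D. lam d)" using assms by (intro sum_mono2) auto
  finally show ?thesis .
qed

text \<open>A dispatcher in \<open>K\<close> splits its rate evenly among its shortest queues. There
  is at least one and all lie in \<open>U\<close>, so its full rate arrives in \<open>U\<close>; the
  other dispatchers can only add to the right side.\<close>

lemma sum_arrival_rate_ge: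
  assumes fin: "finite D" "finite U" and K: "K \<subseteq> D" and lam: "\<And>d. d \<in> D \<Longrightarrow> lam d \<ge> 0"
    and sq: "\<And>d. d \<in> K \<Longrightarrow> shortest_queues E d x \<subseteq> U \<and> shortest_queues E d x \<noteq> {}"
  shows "(\<Sum>d\<in>K. lam d) \<le> (\<Sum>u\<in>U. arrival_rate D E lam x u)"
proof -
  let ?r = "\<lambda>d. lam d / real (card (shortest_queues E d x))"
  have finK: "finite K" using K fin finite_subset by blast
  have "(\<Sum>d\<in>K. lam d) = (\<Sum>d\<in>K. \<Sum>u | u \<in> U \<and> u \<in> shortest_queues E d x. ?r d)"
  proof (intro sum.cong refl)
    fix d assume d: "d \<in> K"
    then have "{u. u \<in> U \<and> u \<in> shortest_queues E d x} = shortest_queues E d x"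
      using sq by auto
    moreover have "card (shortest_queues E d x) \<noteq> 0"
      using sq[OF d] finite_subset[OF _ fin(2)] by auto
    ultimately show "lam d = (\<Sum>u | u \<in> U \<and> u \<in> shortest_queues E d x. ?r d)" by simp
  qed
  also have "\<dots> = (\<Sum>u\<in>U. \<Sum>d | d \<in> K \<and> u \<in> shortest_queues E d x. ?r d)"
    by (rule sum.swap_restrict[OF finK fin(2)])
  also have "\<dots> \<le> (\<Sum>u\<in>U. arrival_rate D E lam x u)"
    unfolding arrival_rate_def using K fin lam by (intro sum_mono sum_mono2) auto
  finally show ?thesis .
qed

section \<open>Total rates into a set of states\<close>

text \<open>Truncated subtraction puts \<open>x\<close> itself among the moves when some queue is
  empty; the departure rate attached to that move is 0.\<close>

definition load_moves :: "'s set \<Rightarrow> ('s \<Rightarrow> nat) \<Rightarrow> ('s \<Rightarrow> nat) set" where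
  "load_moves S x = (\<lambda>u. x(u := x u + 1)) ` S \<union> (\<lambda>u. x(u := x u - 1)) ` S"

lemma finite_load_moves: "finite S \<Longrightarrow> finite (load_moves S x)"
  by (simp add: load_moves_def)

lemma load_moves_subset: "x \<in> load_states S \<Longrightarrow> load_moves S x \<subseteq> load_states S"
  by (auto simp: load_moves_def load_states_def PiE_def extensional_def)

lemma load_balancing_rate_outside_moves:
  "y \<notin> load_moves S x \<Longrightarrow> load_balancing_rate D S E lam mu x y = 0"
proof -
  assume "y \<notin> load_moves S x"
  then have "{u \<in> S. y = x(u := x u + 1)} = {}" "{u \<in> S. y = x(u := x u - 1)} = {}"
    by (auto simp: load_moves_def)
  then show ?thesis unfolding load_balancing_rate_def by (simp only: sum.empty add_0)
qed

text \<open>Each \<open>u\<close> contributes to exactly one \<open>y\<close>, namely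
  \<open>f u\<close>, which turns a sum of jump rates over target states into a sum over
  servers.\<close>

lemma sum_fibres:
  fixes g :: "'a \<Rightarrow> 'b::comm_monoid_add"
  assumes "finite S" "finite T" "f ` S \<subseteq> T"
  shows "(\<Sum>y\<in>T \<inter> Z. \<Sum>u | u \<in> S \<and> y = f u. g u) = (\<Sum>u | u \<in> S \<and> f u \<in> Z. g u)"
proof -
  have "(\<Sum>y\<in>T \<inter> Z. \<Sum>u | u \<in> S \<and> y = f u. g u)
          = (\<Sum>u\<in>S. \<Sum>y | y \<in> T \<inter> Z \<and> y = f u. g u)"
    using assms by (intro sum.swap_restrict) auto
  also have "\<dots> = (\<Sum>u\<in>S. if f u \<in> Z then g u else 0)"
  proof (intro sum.cong refl)
    fix u assume "u \<in> S"
    then have "{y \<in> T \<inter> Z. y = f u} = (if f u \<in> Z then {f u} else {})" using assms by auto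
    then show "(\<Sum>y | y \<in> T \<inter> Z \<and> y = f u. g u) = (if f u \<in> Z then g u else 0)" by simp
  qed
  also have "\<dots> = (\<Sum>u | u \<in> S \<and> f u \<in> Z. g u)"
    using assms by (simp add: sum.inter_filter)
  finally show ?thesis .
qed

lemma sum_load_balancing_rate:
  assumes "finite S"
  shows "(\<Sum>y\<in>load_moves S x \<inter> Z. load_balancing_rate D S E lam mu x y) =
           (\<Sum>u | u \<in> S \<and> x(u := x u + 1) \<in> Z. arrival_rate D E lam x u) +
           (\<Sum>u | u \<in> S \<and> x(u := x u - 1) \<in> Z. departure_rate mu x u)"
  unfolding load_balancing_rate_def sum.distrib
  using assms by (intro arg_cong2[where f = "(+)"] sum_fibres) (auto simp: load_moves_def)

text \<open>By \<open>up\<close>, arrivals never leave \<open>A\<close>, so only departures count in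
  the outflow, where each server is charged its full rate \<open>mu u\<close> even when idle.
  Departures into \<open>A\<close> are nonnegative and are dropped from the inflow.\<close>

lemma load_balancing_cut_bound:
  assumes stat: "load_balancing_stationary D S E lam mu \<pi>"
    and fin: "finite D" "finite S"
    and lam: "\<And>d. d \<in> D \<Longrightarrow> lam d \<ge> 0" and mu: "\<And>u. u \<in> S \<Longrightarrow> mu u \<ge> 0"
    and up: "\<And>x u. x \<in> A \<Longrightarrow> u \<in> S \<Longrightarrow> x(u := x u + 1) \<in> A"
    and inflow: "\<And>x. x \<in> H \<Longrightarrow>
      x \<notin> A \<and> a \<le> (\<Sum>u | u \<in> S \<and> x(u := x u + 1) \<in> A. arrival_rate D E lam x u)"
    and outflow: "\<And>x. x \<in> A \<Longrightarrow> (\<Sum>u | u \<in> S \<and> x(u := x u - 1) \<notin> A. mu u) \<le> b"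
    and b: "b \<ge> 0"
  shows "a * measure_pmf.prob \<pi> H \<le> b"
proof (rule stationary_cut_bound)
  let ?q = "load_balancing_rate D S E lam mu"
  have dep: "0 \<le> departure_rate mu x u \<and> departure_rate mu x u \<le> mu u" if "u \<in> S" for x u
    using mu[OF that] by (simp add: departure_rate_def)
  show "stationary_distribution (load_states S) ?q \<pi>"
    using stat by (simp add: load_balancing_stationary_def)
  show "finite (load_moves S x) \<and> load_moves S x \<subseteq> load_states S \<and>
          (\<forall>y\<in>load_states S - load_moves S x. ?q x y = 0)" if "x \<in> load_states S" for x
    using that fin by (simp add: finite_load_moves load_moves_subset load_balancing_rate_outside_moves)
  show "?q x y \<ge> 0" for x y
    unfolding load_balancing_rate_def using lam dep
    by (intro add_nonneg_nonneg sum_nonneg arrival_rate_nonneg) auto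
  \<comment> \<open>The bound only has to be uniform in the state, so every server is charged the
    total arrival rate.\<close>
  show "(\<Sum>y\<in>load_moves S x. ?q x y) \<le> (\<Sum>u\<in>S. (\<Sum>d\<in>D. lam d)) + (\<Sum>u\<in>S. mu u)" for x
    using sum_load_balancing_rate[OF fin(2), where x = x and Z = UNIV and D = D and E = E and lam = lam and mu = mu] fin lam dep
    by (auto intro!: add_mono sum_mono arrival_rate_le simp del: sum_constant)
  show "x \<notin> A \<and> a \<le> (\<Sum>y\<in>load_moves S x \<inter> A. ?q x y)" if "x \<in> H" for x
  proof -
    have "0 \<le> (\<Sum>u | u \<in> S \<and> x(u := x u - 1) \<in> A. departure_rate mu x u)"
      using dep by (intro sum_nonneg) auto
    then show ?thesis
      using inflow[OF that] by (simp only: sum_load_balancing_rate[OF fin(2)]) simp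
  qed
  show "(\<Sum>y\<in>load_moves S x - A. ?q x y) \<le> b" if "x \<in> A" for x
  proof -
    have "{u. u \<in> S \<and> x(u := x u + 1) \<in> - A} = {}" using up that by auto
    then have "(\<Sum>y\<in>load_moves S x - A. ?q x y)
                 = (\<Sum>u | u \<in> S \<and> x(u := x u - 1) \<in> - A. departure_rate mu x u)"
      by (simp only: Diff_eq sum_load_balancing_rate[OF fin(2)] sum.empty add_0)
    also have "\<dots> \<le> (\<Sum>u | u \<in> S \<and> x(u := x u - 1) \<in> - A. mu u)"
      using dep by (intro sum_mono) auto
    also have "\<dots> \<le> b" using outflow[OF that] by simp
    finally show ?thesis .
  qed
  show "b \<ge> 0" by (rule b)
qed

text \<open>Outside two unlikely events, the failure of \<open>G\<close> and
  \<open>Z n x < M\<close>, the cut bound gives \<open>L\<close> probability at most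
  \<open>b / (M - c)\<close>, and \<open>M\<close> is arbitrary. In the applications
  \<open>L\<close> is the level just below a cut, \<open>G\<close> concerns the central servers, and
  \<open>Z\<close> counts the dispatchers that drive the inflow.\<close>

lemma prob_tendsto_0_of_cut_bound:
  fixes \<pi> :: "nat \<Rightarrow> 'a pmf" and Z :: "nat \<Rightarrow> 'a \<Rightarrow> nat"
  assumes G: "(\<lambda>n. measure_pmf.prob (\<pi> n) {x. \<not> G x}) \<longlonglongrightarrow> 0"
    and Z: "\<And>M. (\<lambda>n. measure_pmf.prob (\<pi> n) {x. Z n x < M}) \<longlonglongrightarrow> 0"
    and cut: "\<And>n M. n \<ge> 1 \<Longrightarrow>
      (real M - c) * measure_pmf.prob (\<pi> n) {x. L n x \<and> G x \<and> M \<le> Z n x} \<le> b"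
  shows "(\<lambda>n. measure_pmf.prob (\<pi> n) {x. L n x}) \<longlonglongrightarrow> 0"
proof (rule LIMSEQ_I)
  fix e :: real assume e: "e > 0"
  \<comment> \<open>Chosen to make \<open>b / (M - c)\<close> less than \<open>e / 3\<close>; the
    absolute value keeps \<open>M - c\<close> positive for negative \<open>b\<close> too.\<close>
  obtain M :: nat where M: "real M > c + \<bar>b\<bar> * 3 / e" using reals_Archimedean2 by blast
  have pos: "real M - c > 0" using M e by (smt (verit) divide_nonneg_pos abs_ge_zero)
  have Mb: "b / (real M - c) < e / 3"
  proof -
    have "\<bar>b\<bar> * 3 < e * (real M - c)" using M e by (simp add: field_simps)
    then show ?thesis using pos e by (simp add: field_simps)
  qed
  have "\<forall>\<^sub>F n in sequentially. measure_pmf.prob (\<pi> n) {x. \<not> G x} < e / 3"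
    using e by (intro order_tendstoD(2)[OF G]) auto
  moreover have "\<forall>\<^sub>F n in sequentially. measure_pmf.prob (\<pi> n) {x. Z n x < M} < e / 3"
    using e by (intro order_tendstoD(2)[OF Z]) auto
  ultimately have "\<forall>\<^sub>F n in sequentially. measure_pmf.prob (\<pi> n) {x. L n x} < e"
    using eventually_ge_at_top[of 1]
  proof eventually_elim
    case (elim n)
    let ?p = "measure_pmf.prob (\<pi> n)"
    let ?H = "{x. L n x \<and> G x \<and> M \<le> Z n x}"
    have "?p {x. L n x} \<le> ?p ({x. \<not> G x} \<union> {x. Z n x < M} \<union> ?H)"
      by (intro measure_pmf.finite_measure_mono) auto
    also have "\<dots> \<le> ?p {x. \<not> G x} + ?p {x. Z n x < M} + ?p ?H"
      by (intro order_trans[OF measure_Un_le] add_mono) auto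
    also have "?p ?H \<le> b / (real M - c)"
      using cut[of n M] elim pos by (simp add: field_simps)
    finally show ?case using elim(1,2) Mb by linarith
  qed
  then show "\<exists>n0. \<forall>n\<ge>n0. norm (measure_pmf.prob (\<pi> n) {x. L n x} - 0) < e"
    by (auto simp: eventually_sequentially)
qed


section \<open>Dandelion networks\<close>

locale dandelion =
  fixes C :: "'s set" and B :: "nat \<Rightarrow> 's set" and lam mu :: real
    and \<pi> :: "nat \<Rightarrow> ('s \<Rightarrow> nat) pmf"
  assumes finite_C: "finite C"
    and finite_B: "\<And>d. d \<ge> 1 \<Longrightarrow> finite (B d)"
    and card_B: "\<And>d. d \<ge> 1 \<Longrightarrow> card (B d) = card (B 1)"
    and disjoint_B: "disjoint_family_on B {1..}"
    and lam_pos: "lam > 0" and mu_pos: "mu > 0"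
    and stationary: "\<And>n. n \<ge> 1 \<Longrightarrow>
      load_balancing_stationary (dandelion_dispatchers n) (dandelion_servers C B n)
        (dandelion_edges C B n) (\<lambda>_. lam) (\<lambda>_. mu) (\<pi> n)"
begin

abbreviation "D \<equiv> dandelion_dispatchers"
abbreviation "S \<equiv> dandelion_servers C B"
abbreviation "E \<equiv> dandelion_edges C B"
abbreviation "prb n X \<equiv> measure_pmf.prob (\<pi> n) {x. X x}"

lemma finite_D: "finite (D n)" and D_ge_1: "d \<in> D n \<Longrightarrow> d \<ge> 1"
  by (auto simp: dandelion_dispatchers_def)

lemma finite_S: "finite (S n)"
  using finite_C finite_B by (auto simp: dandelion_servers_def dandelion_dispatchers_def)

lemma mem_E_iff: "d \<in> D n \<Longrightarrow> (d, u) \<in> E n \<longleftrightarrow> u \<in> B d \<union> C"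
  by (auto simp: dandelion_edges_def)

lemma shortest_queues_dandelion:
  assumes "d \<in> D n"
  shows "shortest_queues (E n) d x \<subseteq> B d \<union> C" "finite (shortest_queues (E n) d x)"
proof -
  show "shortest_queues (E n) d x \<subseteq> B d \<union> C"
    using shortest_queues_subset[of "E n" d x] mem_E_iff[OF assms] by auto
  then show "finite (shortest_queues (E n) d x)"
    using finite_C finite_B[OF D_ge_1[OF assms]] finite_subset by blast
qed

text \<open>Capping at \<open>k\<close> gives the load a maximum, reached exactly when every
  boundary server of \<open>d\<close> has at least \<open>k\<close> tasks, so that only finitely
  many levels have to be climbed.\<close>

definition boundary_load :: "nat \<Rightarrow> nat \<Rightarrow> ('s \<Rightarrow> nat) \<Rightarrow> nat" where
  "boundary_load k d x = (\<Sum>u\<in>B d. min (x u) k)"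

text \<open>Its cardinality is the \<open>Y\<^sub>j\<close> of the opening outline.\<close>

definition loaded_dispatchers :: "nat \<Rightarrow> nat \<Rightarrow> nat \<Rightarrow> ('s \<Rightarrow> nat) \<Rightarrow> nat set" where
  "loaded_dispatchers k j n x = {d \<in> D n. j \<le> boundary_load k d x}"

lemma finite_loaded_dispatchers: "finite (loaded_dispatchers k j n x)"
  by (simp add: loaded_dispatchers_def finite_D)

section \<open>Effect of single moves on the boundary loads\<close>

lemma boundary_load_upd_other: "u \<notin> B d \<Longrightarrow> boundary_load k d (x(u := v)) = boundary_load k d x"
  unfolding boundary_load_def by (intro sum.cong) auto

lemma boundary_load_mono: "x \<le> y \<Longrightarrow> boundary_load k d x \<le> boundary_load k d y"
  unfolding boundary_load_def by (intro sum_mono) (simp add: le_fun_def min.coboundedI1 min_le_iff_disj)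

lemma boundary_load_incr:
  assumes "d \<ge> 1" "u \<in> B d" "x u < k"
  shows "boundary_load k d (x(u := x u + 1)) = boundary_load k d x + 1"
proof -
  have "(\<Sum>v\<in>B d - {u}. min ((x(u := x u + 1)) v) k) = (\<Sum>v\<in>B d - {u}. min (x v) k)"
    by (intro sum.cong) auto
  then show ?thesis using assms finite_B
    by (simp add: boundary_load_def sum.remove[of "B d" u])
qed

lemma boundary_load_less_iff:
  assumes "d \<ge> 1"
  shows "boundary_load k d x < k * card (B 1) \<longleftrightarrow> (\<exists>u\<in>B d. x u < k)"
proof
  assume "\<exists>u\<in>B d. x u < k"
  then have "boundary_load k d x < (\<Sum>u\<in>B d. k)"
    unfolding boundary_load_def using assms finite_B by (intro sum_strict_mono_ex1) (auto simp: min_less_iff_disj)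
  then show "boundary_load k d x < k * card (B 1)" using card_B[OF assms] by (simp add: mult.commute)
next
  assume less: "boundary_load k d x < k * card (B 1)"
  show "\<exists>u\<in>B d. x u < k"
  proof (rule ccontr)
    assume "\<not> ?thesis"
    then have "boundary_load k d x = (\<Sum>u\<in>B d. k)"
      unfolding boundary_load_def by (intro sum.cong) (auto simp: not_less)
    then show False using less card_B[OF assms] by (simp add: mult.commute)
  qed
qed

lemma loaded_dispatchers_mono: "x \<le> y \<Longrightarrow> loaded_dispatchers k j n x \<subseteq> loaded_dispatchers k j n y"
  using boundary_load_mono order_trans by (fastforce simp: loaded_dispatchers_def)

text \<open>By disjointness of the boundary sets, a departure changes the load of one dispatcher only.\<close>
lemma critical_departure:
  assumes ge: "card (loaded_dispatchers k j n x) \<ge> Suc m"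
    and lt: "card (loaded_dispatchers k j n (x(u := v))) < Suc m"
  shows "u \<in> (\<Union>d\<in>loaded_dispatchers k j n x. B d) \<and> card (loaded_dispatchers k j n x) \<le> Suc m"
proof -
  let ?J = "loaded_dispatchers k j n x" and ?J' = "loaded_dispatchers k j n (x(u := v))"
  have "\<not> ?J \<subseteq> ?J'" using ge lt card_mono[OF finite_loaded_dispatchers] by (metis leD le_less_trans)
  then obtain d where d: "d \<in> ?J" "d \<notin> ?J'" by blast
  then have u: "u \<in> B d" using boundary_load_upd_other by (fastforce simp: loaded_dispatchers_def)
  have "?J - {d} \<subseteq> ?J'"
  proof
    fix d' assume d': "d' \<in> ?J - {d}"
    then have "u \<notin> B d'"
      using u d disjoint_family_onD[OF disjoint_B, of d d'] D_ge_1[of d n] D_ge_1[of d' n]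
      by (auto simp: loaded_dispatchers_def)
    then show "d' \<in> ?J'" using d' by (simp add: loaded_dispatchers_def boundary_load_upd_other)
  qed
  then have "card (?J - {d}) \<le> card ?J'" by (intro card_mono finite_loaded_dispatchers)
  then show ?thesis using u d lt by auto
qed

section \<open>The two cut bounds\<close>

text \<open>On the event, at least \<open>M - m\<close> dispatchers have load exactly
  \<open>j\<close> and send their tasks to boundary servers with fewer than \<open>k\<close> tasks.
  Subtraction in the reals makes the bound trivial for \<open>M \<le> m\<close>; dividing by
  \<open>lam\<close> gives the shape required by \<open>prob_tendsto_0_of_cut_bound\<close> with
  \<open>c = m\<close>.\<close>

lemma boundary_cut_bound:
  assumes n: "n \<ge> 1" and j: "Suc j \<le> k * card (B 1)"
  shows "(real M - real m) * prb n (\<lambda>x. card (loaded_dispatchers k (Suc j) n x) = m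
            \<and> (\<forall>c\<in>C. k \<le> x c) \<and> M \<le> card (loaded_dispatchers k j n x))
          \<le> real (Suc m * card (B 1)) * mu / lam"
proof -
  let ?J = "loaded_dispatchers k"
  let ?A = "{x. Suc m \<le> card (?J (Suc j) n x)}"
  let ?H = "{x. card (?J (Suc j) n x) = m \<and> (\<forall>c\<in>C. k \<le> x c) \<and> M \<le> card (?J j n x)}"
  have "((real M - real m) * lam) * measure_pmf.prob (\<pi> n) ?H \<le> real (Suc m * card (B 1)) * mu"
  proof (rule load_balancing_cut_bound[OF stationary[OF n] finite_D finite_S, where A = ?A])
    fix x u assume "x \<in> ?A"
    moreover have "card (?J (Suc j) n x) \<le> card (?J (Suc j) n (x(u := x u + 1)))"
      by (intro card_mono finite_loaded_dispatchers loaded_dispatchers_mono) (simp add: le_fun_def)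
    ultimately show "x(u := x u + 1) \<in> ?A" by simp
  next
    fix x assume x: "x \<in> ?H"
    let ?U = "{u. u \<in> S n \<and> x(u := x u + 1) \<in> ?A}"
    \<comment> \<open>The dispatchers of load exactly \<open>j\<close>: every task arriving at one
      of them moves the state into \<open>?A\<close>.\<close>
    let ?K = "?J j n x - ?J (Suc j) n x"
    have "?J (Suc j) n x \<subseteq> ?J j n x" by (auto simp: loaded_dispatchers_def)
    then have "card ?K = card (?J j n x) - m"
      using x by (simp add: card_Diff_subset finite_loaded_dispatchers)
    then have "(real M - real m) * lam \<le> real (card ?K) * lam"
      using x lam_pos by (intro mult_right_mono) auto
    also have "\<dots> = (\<Sum>d\<in>?K. lam)" by simp
    also have "\<dots> \<le> (\<Sum>u\<in>?U. arrival_rate (D n) (E n) (\<lambda>_. lam) x u)"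
    proof (intro sum_arrival_rate_ge finite_D conjI)
      fix d assume d: "d \<in> ?K"
      then have dD: "d \<in> D n" and load: "boundary_load k d x = j"
        by (auto simp: loaded_dispatchers_def)
      then obtain v where v: "v \<in> B d" "x v < k"
        using boundary_load_less_iff[of d k x] j D_ge_1 by auto
      have fin: "finite {u. (d, u) \<in> E n}"
        using finite_C finite_B[OF D_ge_1[OF dD]] by (simp add: mem_E_iff[OF dD])
      show "shortest_queues (E n) d x \<noteq> {}"
        using v by (intro shortest_queues_nonempty[OF fin, of v]) (simp add: mem_E_iff[OF dD])
      show "shortest_queues (E n) d x \<subseteq> ?U"
      proof
        fix u assume u: "u \<in> shortest_queues (E n) d x"
        \<comment> \<open>Since \<open>v\<close> is below \<open>k\<close>, so is every shortest
          queue, which rules out the central servers.\<close>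
        then have "x u < k" using shortest_queues_le[OF u, of v] v by (simp add: mem_E_iff[OF dD])
        moreover from this have "u \<notin> C" using x by (auto simp: not_less)
        ultimately have uB: "u \<in> B d" "x u < k"
          using u shortest_queues_dandelion(1)[OF dD] by auto
        let ?y = "x(u := x u + 1)"
        \<comment> \<open>The arrival adds \<open>d\<close> and by monotonicity loses no dispatcher,
          so the count rises from \<open>m\<close> to at least \<open>m + 1\<close>.\<close>
        have "insert d (?J (Suc j) n x) \<subseteq> ?J (Suc j) n ?y"
          using loaded_dispatchers_mono[of x ?y k "Suc j" n]
            boundary_load_incr[of d u x k] D_ge_1[OF dD] uB dD load
          by (auto simp: loaded_dispatchers_def le_fun_def)
        then have "card (insert d (?J (Suc j) n x)) \<le> card (?J (Suc j) n ?y)"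
          by (intro card_mono finite_loaded_dispatchers)
        then have "?y \<in> ?A" using d x by (simp add: finite_loaded_dispatchers)
        then show "u \<in> ?U" using uB dD by (auto simp: dandelion_servers_def)
      qed
    qed (use lam_pos in \<open>auto simp: loaded_dispatchers_def finite_S\<close>)
    finally show "x \<notin> ?A \<and> (real M - real m) * lam
        \<le> (\<Sum>u | u \<in> S n \<and> x(u := x u + 1) \<in> ?A. arrival_rate (D n) (E n) (\<lambda>_. lam) x u)"
      using x by auto
  next
    fix x assume x: "x \<in> ?A"
    let ?U = "{u. u \<in> S n \<and> x(u := x u - 1) \<notin> ?A}"
    \<comment> \<open>That at most \<open>Suc m\<close> dispatchers are loaded is known only from an
      actual critical departure, hence the case distinction.\<close>
    have "card ?U \<le> Suc m * card (B 1)"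
    proof (cases "?U = {}")
      case False
      have crit: "u \<in> (\<Union>d\<in>?J (Suc j) n x. B d) \<and> card (?J (Suc j) n x) \<le> Suc m" if "u \<in> ?U" for u
        using critical_departure[of m k "Suc j" n x u "x u - 1"] x that by simp
      have "card ?U \<le> card (\<Union>d\<in>?J (Suc j) n x. B d)"
        using crit by (intro card_mono finite_UN_I finite_loaded_dispatchers finite_B)
          (auto simp: loaded_dispatchers_def dest: D_ge_1)
      also have "\<dots> \<le> (\<Sum>d\<in>?J (Suc j) n x. card (B d))"
        by (intro card_UN_le finite_loaded_dispatchers)
      also have "\<dots> = (\<Sum>d\<in>?J (Suc j) n x. card (B 1))"
        by (intro sum.cong refl card_B) (auto simp: loaded_dispatchers_def dest: D_ge_1)
      also have "\<dots> \<le> Suc m * card (B 1)" using crit False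
        by (auto simp del: mult_Suc intro!: mult_right_mono)
      finally show ?thesis .
    qed (simp only: card.empty zero_le)
    then show "(\<Sum>u\<in>?U. mu) \<le> real (Suc m * card (B 1)) * mu"
      using mu_pos by (simp del: of_nat_mult mult_Suc)
  qed (use lam_pos mu_pos in auto)
  then show ?thesis using lam_pos by (simp add: field_simps)
qed

text \<open>All servers adjacent to a dispatcher of maximal load have at least \<open>k\<close>
  tasks, so \<open>c\<close> with exactly \<open>k\<close> is among its shortest queues and receives
  a share of at least \<open>lam / (card (B 1) + card C)\<close>. Only a departure from
  \<open>c\<close> crosses the cut downwards. The form \<open>real M - 0\<close> matches
  \<open>prob_tendsto_0_of_cut_bound\<close> with \<open>c = 0\<close>.\<close>

lemma central_cut_bound:
  assumes n: "n \<ge> 1" and c: "c \<in> C"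
  shows "(real M - 0) * prb n (\<lambda>x. x c = k \<and> (\<forall>c\<in>C. k \<le> x c)
            \<and> M \<le> card (loaded_dispatchers k (k * card (B 1)) n x))
          \<le> mu * real (card (B 1) + card C) / lam"
proof -
  let ?J = "loaded_dispatchers k (k * card (B 1)) n"
  let ?A = "{x. Suc k \<le> x c}"
  let ?H = "{x. x c = k \<and> (\<forall>c\<in>C. k \<le> x c) \<and> M \<le> card (?J x)}"
  let ?s = "card (B 1) + card C"
  have s: "?s > 0" using c finite_C by (auto simp: card_gt_0_iff)
  have cS: "c \<in> S n" using c by (simp add: dandelion_servers_def)
  have "(real M * (lam / real ?s)) * measure_pmf.prob (\<pi> n) ?H \<le> mu"
  proof (rule load_balancing_cut_bound[OF stationary[OF n] finite_D finite_S, where A = ?A])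
    fix x assume x: "x \<in> ?H"
    have sq: "c \<in> shortest_queues (E n) d x \<and> card (shortest_queues (E n) d x) \<le> ?s
                \<and> card (shortest_queues (E n) d x) > 0" if d: "d \<in> ?J x" for d
    proof -
      have dD: "d \<in> D n" and full: "\<forall>u\<in>B d. k \<le> x u"
        using d boundary_load_less_iff[of d k x] D_ge_1[of d n]
        by (auto simp: loaded_dispatchers_def not_less)
      then have mem: "c \<in> shortest_queues (E n) d x"
        using x c by (auto simp: shortest_queues_def is_arg_min_linorder mem_E_iff)
      have "card (shortest_queues (E n) d x) \<le> card (B d \<union> C)"
        using finite_C finite_B[OF D_ge_1[OF dD]]
        by (intro card_mono shortest_queues_dandelion(1) dD) auto
      also have "\<dots> \<le> ?s" using card_Un_le[of "B d" C] card_B[OF D_ge_1[OF dD]] by simp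
      finally show ?thesis using mem shortest_queues_dandelion(2)[OF dD] by (auto simp: card_gt_0_iff)
    qed
    have "real M * (lam / real ?s) \<le> real (card (?J x)) * (lam / real ?s)"
      using x lam_pos by (intro mult_right_mono) auto
    also have "\<dots> = (\<Sum>d\<in>?J x. lam / real ?s)" by simp
    also have "\<dots> \<le> (\<Sum>d\<in>?J x. lam / real (card (shortest_queues (E n) d x)))"
      using lam_pos sq s by (intro sum_mono divide_left_mono mult_pos_pos of_nat_mono)
        (auto simp del: of_nat_add)
    also have "\<dots> \<le> arrival_rate (D n) (E n) (\<lambda>_. lam) x c"
      unfolding arrival_rate_def using lam_pos sq
      by (intro sum_mono2) (auto simp: finite_D loaded_dispatchers_def)
    also have "\<dots> = (\<Sum>u\<in>{c}. arrival_rate (D n) (E n) (\<lambda>_. lam) x u)" by simp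
    also have "\<dots> \<le> (\<Sum>u | u \<in> S n \<and> x(u := x u + 1) \<in> ?A. arrival_rate (D n) (E n) (\<lambda>_. lam) x u)"
      using x cS lam_pos finite_S by (intro sum_mono2 arrival_rate_nonneg) auto
    finally show "x \<notin> ?A \<and> real M * (lam / real ?s)
        \<le> (\<Sum>u | u \<in> S n \<and> x(u := x u + 1) \<in> ?A. arrival_rate (D n) (E n) (\<lambda>_. lam) x u)"
      using x by simp
  next
    fix x assume "x \<in> ?A"
    then have "(\<Sum>u | u \<in> S n \<and> x(u := x u - 1) \<notin> ?A. mu) \<le> (\<Sum>u\<in>{c}. mu)"
      using mu_pos by (intro sum_mono2) (auto split: if_splits)
    then show "(\<Sum>u | u \<in> S n \<and> x(u := x u - 1) \<notin> ?A. mu) \<le> mu" by simp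
  qed (use lam_pos mu_pos in auto)
  then have "real M * lam * measure_pmf.prob (\<pi> n) ?H \<le> mu * real ?s"
    using s by (simp add: divide_simps del: of_nat_add split: if_splits)
  then show ?thesis using lam_pos by (simp add: pos_le_divide_eq mult.assoc mult.left_commute mult.commute)
qed

section \<open>Induction over load levels and queue lengths\<close>

text \<open>Once the count at level \<open>j\<close> exceeds every bound in probability, the cut
  bound makes each single value \<open>m\<close> of the count at level \<open>Suc j\<close>
  unlikely. The inner induction adds up the finitely many values below \<open>M\<close>.\<close>

lemma boundary_loaded_whp:
  assumes central: "(\<lambda>n. prb n (\<lambda>x. \<not> (\<forall>c\<in>C. k \<le> x c))) \<longlonglongrightarrow> 0"
    and "j \<le> k * card (B 1)"
  shows "(\<lambda>n. prb n (\<lambda>x. card (loaded_dispatchers k j n x) < M)) \<longlonglongrightarrow> 0"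
  using assms(2)
proof (induction j arbitrary: M)
  case 0
  \<comment> \<open>Every load is at least 0, so all \<open>n\<close> dispatchers count at level
    0.\<close>
  have "\<forall>\<^sub>F n in sequentially. prb n (\<lambda>x. card (loaded_dispatchers k 0 n x) < M) = 0"
    using eventually_ge_at_top[of M]
  proof eventually_elim
    case (elim n)
    moreover have "loaded_dispatchers k 0 n x = {1..n}" for x
      by (auto simp: loaded_dispatchers_def dandelion_dispatchers_def)
    ultimately show ?case by simp
  qed
  then show ?case by (rule tendsto_eventually)
next
  case (Suc j)
  have level: "(\<lambda>n. prb n (\<lambda>x. card (loaded_dispatchers k (Suc j) n x) = m)) \<longlonglongrightarrow> 0" for m
    using Suc by (intro prob_tendsto_0_of_cut_bound[OF central _ boundary_cut_bound]) auto
  show ?case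
  proof (induction M)
    case (Suc M)
    show ?case
    proof (rule tendsto_sandwich[OF _ _ tendsto_const])
      show "(\<lambda>n. prb n (\<lambda>x. card (loaded_dispatchers k (Suc j) n x) < M)
                 + prb n (\<lambda>x. card (loaded_dispatchers k (Suc j) n x) = M)) \<longlonglongrightarrow> 0"
        using tendsto_add[OF Suc level] by simp
    qed (auto simp: less_Suc_eq Collect_disj_eq intro!: always_eventually measure_Un_le)
  qed simp
qed

text \<open>The passage from \<open>k\<close> to \<open>k + 1\<close> can fail only where some
  central server has exactly \<open>k\<close> tasks. Each of these events is unlikely by the central
  cut, whose inflow is driven by the dispatchers of maximal load \<open>k * card (B 1)\<close>; a
  union bound over the finite set \<open>C\<close> finishes the step.\<close>

lemma central_loaded_whp: "(\<lambda>n. prb n (\<lambda>x. \<not> (\<forall>c\<in>C. k \<le> x c))) \<longlonglongrightarrow> 0"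
proof (induction k)
  case (Suc k)
  have level: "(\<lambda>n. prb n (\<lambda>x. x c = k)) \<longlonglongrightarrow> 0" if "c \<in> C" for c
    by (rule prob_tendsto_0_of_cut_bound[where L = "\<lambda>_ x. x c = k" and c = 0,
          OF Suc boundary_loaded_whp[OF Suc order_refl] central_cut_bound[OF _ that]])
  show ?case
  proof (rule tendsto_sandwich[OF _ _ tendsto_const])
    show "(\<lambda>n. prb n (\<lambda>x. \<not> (\<forall>c\<in>C. k \<le> x c)) + (\<Sum>c\<in>C. prb n (\<lambda>x. x c = k))) \<longlonglongrightarrow> 0"
      using tendsto_add[OF Suc tendsto_sum[of C, OF level]] by simp
    have "prb n (\<lambda>x. \<not> (\<forall>c\<in>C. Suc k \<le> x c))
            \<le> prb n (\<lambda>x. \<not> (\<forall>c\<in>C. k \<le> x c)) + (\<Sum>c\<in>C. prb n (\<lambda>x. x c = k))" for n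
    proof -
      have "prb n (\<lambda>x. \<not> (\<forall>c\<in>C. Suc k \<le> x c))
              \<le> measure_pmf.prob (\<pi> n) ({x. \<not> (\<forall>c\<in>C. k \<le> x c)} \<union> (\<Union>c\<in>C. {x. x c = k}))"
        by (intro measure_pmf.finite_measure_mono) (auto simp: not_less_eq_eq le_Suc_eq)
      also have "\<dots> \<le> prb n (\<lambda>x. \<not> (\<forall>c\<in>C. k \<le> x c)) + (\<Sum>c\<in>C. prb n (\<lambda>x. x c = k))"
        using finite_C
        by (intro order_trans[OF measure_Un_le] add_mono measure_UNION_le) auto
      finally show ?thesis .
    qed
    then show "\<forall>\<^sub>F n in sequentially. prb n (\<lambda>x. \<not> (\<forall>c\<in>C. Suc k \<le> x c))
                 \<le> prb n (\<lambda>x. \<not> (\<forall>c\<in>C. k \<le> x c)) + (\<Sum>c\<in>C. prb n (\<lambda>x. x c = k))"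
      by simp
  qed simp
qed simp

lemma central_queue_whp:
  assumes "c \<in> C"
  shows "(\<lambda>n. prb n (\<lambda>x. x c \<ge> k)) \<longlonglongrightarrow> 1"
proof (rule tendsto_sandwich[OF _ _ _ tendsto_const])
  show "(\<lambda>n. 1 - prb n (\<lambda>x. \<not> (\<forall>c\<in>C. k \<le> x c))) \<longlonglongrightarrow> 1"
    using tendsto_diff[OF tendsto_const[of 1] central_loaded_whp[of k]] by simp
  have "1 - prb n (\<lambda>x. \<not> (\<forall>c\<in>C. k \<le> x c)) \<le> prb n (\<lambda>x. x c \<ge> k)" for n
  proof -
    have "1 - prb n (\<lambda>x. \<not> (\<forall>c\<in>C. k \<le> x c))
            = measure_pmf.prob (\<pi> n) (- {x. \<not> (\<forall>c\<in>C. k \<le> x c)})"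
      using measure_pmf.prob_compl[of "{x. \<not> (\<forall>c\<in>C. k \<le> x c)}" "\<pi> n"]
      by (simp add: Compl_eq_Diff_UNIV)
    also have "\<dots> \<le> prb n (\<lambda>x. x c \<ge> k)"
      using assms by (intro measure_pmf.finite_measure_mono) auto
    finally show ?thesis .
  qed
  then show "\<forall>\<^sub>F n in sequentially. 1 - prb n (\<lambda>x. \<not> (\<forall>c\<in>C. k \<le> x c)) \<le> prb n (\<lambda>x. x c \<ge> k)"
    by simp
qed simp

end

section \<open>Divergence of the expectation\<close>

text \<open>Markov's inequality: the mean is at least \<open>k\<close> times the probability of
  \<open>f x \<ge> k\<close>. The integral takes values in \<open>ennreal\<close>, so the mean is
  allowed to be infinite for individual \<open>n\<close>.\<close>

lemma nn_integral_tendsto_top_of_prob: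
  fixes \<pi> :: "nat \<Rightarrow> 'a pmf" and f :: "'a \<Rightarrow> nat"
  assumes "\<And>k. (\<lambda>n. measure_pmf.prob (\<pi> n) {x. f x \<ge> k}) \<longlonglongrightarrow> 1"
  shows "(\<lambda>n. \<integral>\<^sup>+ x. of_nat (f x) \<partial>measure_pmf (\<pi> n)) \<longlonglongrightarrow> (\<infinity> :: ennreal)"
  unfolding infinity_ennreal_def tendsto_top_iff_ennreal
proof (intro allI impI)
  fix l :: real assume "l \<ge> 0"
  \<comment> \<open>The factor 2 compensates for the probability, which is bounded below only by
    1/2.\<close>
  obtain k :: nat where k: "real k > 2 * l" using reals_Archimedean2 by blast
  have "\<forall>\<^sub>F n in sequentially. measure_pmf.prob (\<pi> n) {x. f x \<ge> k} > 1 / 2"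
    by (rule order_tendstoD(1)[OF assms]) simp
  then show "\<forall>\<^sub>F n in sequentially. ennreal l < (\<integral>\<^sup>+ x. of_nat (f x) \<partial>measure_pmf (\<pi> n))"
  proof eventually_elim
    case (elim n)
    have "l < real k * measure_pmf.prob (\<pi> n) {x. f x \<ge> k}"
      using mult_left_mono[of "1 / 2" "measure_pmf.prob (\<pi> n) {x. f x \<ge> k}" "real k"] elim k by simp
    then have "ennreal l < ennreal (real k * measure_pmf.prob (\<pi> n) {x. f x \<ge> k})"
      using \<open>l \<ge> 0\<close> by (simp add: ennreal_lessI)
    also have "\<dots> = (\<integral>\<^sup>+ x. of_nat k * indicator {x. f x \<ge> k} x \<partial>measure_pmf (\<pi> n))"
      by (simp add: nn_integral_cmult_indicator ennreal_mult measure_pmf.emeasure_eq_measure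
          ennreal_of_nat_eq_real_of_nat)
    also have "\<dots> \<le> (\<integral>\<^sup>+ x. of_nat (f x) \<partial>measure_pmf (\<pi> n))"
      by (intro nn_integral_mono) (auto simp: indicator_def)
    finally show ?case .
  qed
qed

theorem theorem3:
  fixes C :: "'s set" and B :: "nat \<Rightarrow> 's set"
    and lam mu :: real
    and \<pi> :: "nat \<Rightarrow> ('s \<Rightarrow> nat) pmf"
  assumes "finite C"
    and "\<And>d. d \<ge> 1 \<Longrightarrow> finite (B d)"
    and "\<And>d. d \<ge> 1 \<Longrightarrow> card (B d) = card (B 1)"
    and "disjoint_family_on B {1..}"
    and "\<And>d. d \<ge> 1 \<Longrightarrow> C \<inter> B d = {}"
    and "lam > 0" and "mu > 0" and "lam < mu * real (card (B 1))"
    and "\<And>n. n \<ge> 1 \<Longrightarrow>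
           load_balancing_stationary (dandelion_dispatchers n) (dandelion_servers C B n)
             (dandelion_edges C B n) (\<lambda>_. lam) (\<lambda>_. mu) (\<pi> n)"
  shows "(\<forall>k. \<forall>c\<in>C. (\<lambda>n. measure_pmf.prob (\<pi> n) {x. x c \<ge> k}) \<longlonglongrightarrow> 1) \<and>
         (\<forall>c\<in>C. (\<lambda>n. \<integral>\<^sup>+ x. of_nat (x c) \<partial>measure_pmf (\<pi> n)) \<longlonglongrightarrow> (\<infinity> :: ennreal))"
proof -
  interpret dandelion C B lam mu \<pi>
    by (intro dandelion.intro assms) simp
  show ?thesis
    by (intro conjI allI ballI nn_integral_tendsto_top_of_prob central_queue_whp)
qed

end
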